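(* Let $\{P_i=(X_i,Y_i,R_i): i\in I\}$ be a set of polarities and $U$ an ultrafilter on $I$. Then there is an injective bounded-lattice homomorphism $\prod_U(P_i^+)\to(\prod_U P_i)^+$ from the ultraproduct of the stable set lattices $P_i^+$ into the stable set lattice of the ultraproduct polarity $\prod_U P_i$. (Namely, $\alpha^U\mapsto\{f^U\in\prod_U X_i:\{i\in I: f(i)\in\alpha(i)\}\in U\}$ for $\alpha\in\prod_I P_i^+$.)
   Context: A polarity is a triple $P=(X,Y,R)$ with $R\subseteq X\times Y$. For $A\subseteq X$ let $\rho A=\{y\in Y:\forall x\in A,\ xRy\}$ and for $B\subseteq Y$ let $\lambda B=\{x\in X:\forall y\in B,\ xRy\}$. A set $A\subseteq X$ is stable if $\lambda\rho A=A$. The stable set lattice $P^+$ is the set of stable subsets of $X$ under inclusion, a complete lattice with meets given by intersection and $\bigvee G=\lambda\rho(\bigcup G)$; its top is $X$ and bottom $\lambda Y$. The ultraproduct $\prod_U P_i$ is the polarity $(\prod_U X_i,\prod_U Y_i,R^U)$ with $f^UR^Ug^U$ iff $\{i: f(i)R_ig(i)\}\in U$, where $f^U$ is the class of $f$ modulo $f\sim_U g\iff\{i:f(i)=g(i)\}\in U$. $\prod_U(P_i^+)$ is the usual lattice ultraproduct.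
   Formalization: Adds: if U-almost all X_i are nonempty then all are, and likewise for the Y_i. Without it the claim fails, e.g. I={0,1}, U principal at 0, X_1 empty, P_0 with two or more stable sets: the target lattice then has a single element. *)

theory Defs
  imports "HOL-Library.FuncSet" "HOL-Algebra.Complete_Lattice"
begin

section \<open>Polarities and their stable set lattices\<close>

record ('a, 'b) polarity =
  pol_X :: "'a set"
  pol_Y :: "'b set"
  pol_R :: "('a \<times> 'b) set"

definition is_polarity :: "('a, 'b) polarity \<Rightarrow> bool" where
  "is_polarity P \<longleftrightarrow> pol_R P \<subseteq> pol_X P \<times> pol_Y P"

definition rho :: "('a, 'b) polarity \<Rightarrow> 'a set \<Rightarrow> 'b set" where
  "rho P A = {y \<in> pol_Y P. \<forall>x\<in>A. (x, y) \<in> pol_R P}"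

definition lambda :: "('a, 'b) polarity \<Rightarrow> 'b set \<Rightarrow> 'a set" where
  "lambda P B = {x \<in> pol_X P. \<forall>y\<in>B. (x, y) \<in> pol_R P}"

definition stable :: "('a, 'b) polarity \<Rightarrow> 'a set \<Rightarrow> bool" where
  "stable P A \<longleftrightarrow> A \<subseteq> pol_X P \<and> lambda P (rho P A) = A"

text \<open>In \<^theory>\<open>HOL-Algebra.Lattice\<close> joins, meets and bounds are derived from the order;
  the lemmas below compute them.\<close>

definition stable_lattice :: "('a, 'b) polarity \<Rightarrow> 'a set gorder" where
  "stable_lattice P = \<lparr>carrier = {A. stable P A}, eq = (=), le = (\<subseteq>)\<rparr>"

lemma stable_lattice_simps [simp]:
  "A \<in> carrier (stable_lattice P) \<longleftrightarrow> stable P A"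
  "A .=\<^bsub>stable_lattice P\<^esub> B \<longleftrightarrow> A = B"
  "A \<sqsubseteq>\<^bsub>stable_lattice P\<^esub> B \<longleftrightarrow> A \<subseteq> B"
  by (simp_all add: stable_lattice_def)

lemma stable_lambda [simp]: "B \<subseteq> pol_Y P \<Longrightarrow> stable P (lambda P B)"
  unfolding stable_def lambda_def rho_def by blast

lemma rho_subset [simp]: "rho P A \<subseteq> pol_Y P"
  by (auto simp: rho_def)

lemma stable_top [simp]: "stable P (pol_X P)"
  by (auto simp: stable_def lambda_def rho_def)

lemma closure_least:
  assumes "stable P B" "A \<subseteq> B"
  shows "lambda P (rho P A) \<subseteq> B"
  using assms unfolding stable_def lambda_def rho_def by blast

lemma closure_extensive: "A \<subseteq> pol_X P \<Longrightarrow> A \<subseteq> lambda P (rho P A)"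
  by (auto simp: lambda_def rho_def)

lemma stable_subset: "stable P A \<Longrightarrow> A \<subseteq> pol_X P"
  by (simp add: stable_def)

lemma partial_order_stable_lattice: "partial_order (stable_lattice P)"
  by standard (auto simp: stable_lattice_def)

lemma is_lub_stable_lattice:
  assumes "G \<subseteq> carrier (stable_lattice P)"
  shows "is_lub (stable_lattice P) (lambda P (rho P (\<Union>G))) G"
proof -
  have "\<Union>G \<subseteq> pol_X P"
    using assms stable_subset by fastforce
  then have "\<Union>G \<subseteq> lambda P (rho P (\<Union>G))"
    by (rule closure_extensive)
  moreover have "lambda P (rho P (\<Union>G)) \<subseteq> B"
    if "B \<in> Upper (stable_lattice P) G" for B
    using that assms by (intro closure_least) (auto simp: Upper_def subset_iff)
  ultimately show ?thesis
    using assms by (intro least_UpperI) auto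
qed

lemma is_glb_stable_lattice:
  assumes "G \<subseteq> carrier (stable_lattice P)"
  shows "is_glb (stable_lattice P) (pol_X P \<inter> \<Inter>G) G"
proof -
  have "lambda P (rho P (pol_X P \<inter> \<Inter>G)) \<subseteq> A" if "A \<in> insert (pol_X P) G" for A
    using that assms by (intro closure_least) auto
  then have "lambda P (rho P (pol_X P \<inter> \<Inter>G)) \<subseteq> pol_X P \<inter> \<Inter>G"
    by blast
  then have "stable P (pol_X P \<inter> \<Inter>G)"
    unfolding stable_def using closure_extensive[of "pol_X P \<inter> \<Inter>G" P] by auto
  moreover have "B \<subseteq> pol_X P \<inter> \<Inter>G" if "B \<in> Lower (stable_lattice P) G" for B
    using that assms unfolding Lower_def
    by (simp add: subset_iff) (blast dest: stable_subset)
  ultimately show ?thesis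
    using assms by (intro greatest_LowerI) auto
qed

lemma complete_lattice_stable_lattice: "complete_lattice (stable_lattice P)"
  using is_lub_stable_lattice is_glb_stable_lattice
  by (intro partial_order.complete_latticeI partial_order_stable_lattice) blast+

lemma bounded_lattice_stable_lattice: "bounded_lattice (stable_lattice P)"
proof -
  interpret complete_lattice "stable_lattice P"
    by (rule complete_lattice_stable_lattice)
  show ?thesis ..
qed

lemma sup_stable_lattice:
  assumes "G \<subseteq> carrier (stable_lattice P)"
  shows "\<Squnion>\<^bsub>stable_lattice P\<^esub>G = lambda P (rho P (\<Union>G))"
  unfolding Lattice.sup_def
  by (rule some_equality) (fact is_lub_stable_lattice[OF assms],
      rule partial_order.least_unique[OF partial_order_stable_lattice _
        is_lub_stable_lattice[OF assms]])

lemma inf_stable_lattice: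
  assumes "G \<subseteq> carrier (stable_lattice P)"
  shows "\<Sqinter>\<^bsub>stable_lattice P\<^esub>G = pol_X P \<inter> \<Inter>G"
  unfolding Lattice.inf_def
  by (rule some_equality) (fact is_glb_stable_lattice[OF assms],
      rule partial_order.greatest_unique[OF partial_order_stable_lattice _
        is_glb_stable_lattice[OF assms]])

lemma join_stable_lattice:
  assumes "stable P A" "stable P B"
  shows "A \<squnion>\<^bsub>stable_lattice P\<^esub> B = lambda P (rho P (A \<union> B))"
  using assms by (simp add: join_def sup_stable_lattice)

lemma meet_stable_lattice:
  assumes "stable P A" "stable P B"
  shows "A \<sqinter>\<^bsub>stable_lattice P\<^esub> B = A \<inter> B"
  using assms by (auto simp: meet_def inf_stable_lattice dest: stable_subset)

lemma top_stable_lattice: "\<top>\<^bsub>stable_lattice P\<^esub> = pol_X P"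
proof -
  interpret bounded_lattice "stable_lattice P" by (rule bounded_lattice_stable_lattice)
  show ?thesis using top_eq[of "pol_X P"] by (auto dest: stable_subset)
qed

lemma bottom_stable_lattice: "\<bottom>\<^bsub>stable_lattice P\<^esub> = lambda P (pol_Y P)"
proof -
  interpret bounded_lattice "stable_lattice P" by (rule bounded_lattice_stable_lattice)
  have "lambda P (pol_Y P) \<subseteq> A" if "stable P A" for A
  proof -
    have "lambda P (pol_Y P) \<subseteq> lambda P (rho P A)"
      by (auto simp: lambda_def rho_def)
    then show ?thesis using that by (simp add: stable_def)
  qed
  then show ?thesis using bottom_eq[of "lambda P (pol_Y P)"] by simp
qed


section \<open>Ultraproducts\<close>

definition ultrafilter_on :: "'i set \<Rightarrow> 'i set set \<Rightarrow> bool" where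
  "ultrafilter_on I U \<longleftrightarrow>
     U \<subseteq> Pow I \<and> I \<in> U \<and> {} \<notin> U \<and>
     (\<forall>A\<in>U. \<forall>B\<in>U. A \<inter> B \<in> U) \<and>
     (\<forall>A\<in>U. \<forall>B. A \<subseteq> B \<and> B \<subseteq> I \<longrightarrow> B \<in> U) \<and>
     (\<forall>A. A \<subseteq> I \<longrightarrow> A \<in> U \<or> I - A \<in> U)"

text \<open>Elements of the Cartesian product of the family \<open>X\<close> are extensional functions, so that
  their values outside the index set \<open>I\<close> carry no information.\<close>

definition ultra_rel ::
    "'i set \<Rightarrow> 'i set set \<Rightarrow> ('i \<Rightarrow> 'a set) \<Rightarrow> (('i \<Rightarrow> 'a) \<times> ('i \<Rightarrow> 'a)) set" where
  "ultra_rel I U X =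
     {(f, g). f \<in> Pi\<^sub>E I X \<and> g \<in> Pi\<^sub>E I X \<and> {i \<in> I. f i = g i} \<in> U}"

definition ultra_class ::
    "'i set \<Rightarrow> 'i set set \<Rightarrow> ('i \<Rightarrow> 'a set) \<Rightarrow> ('i \<Rightarrow> 'a) \<Rightarrow> ('i \<Rightarrow> 'a) set" where
  "ultra_class I U X f = ultra_rel I U X `` {f}"

definition ultra_carrier ::
    "'i set \<Rightarrow> 'i set set \<Rightarrow> ('i \<Rightarrow> 'a set) \<Rightarrow> ('i \<Rightarrow> 'a) set set" where
  "ultra_carrier I U X = Pi\<^sub>E I X // ultra_rel I U X"

definition ultraproduct_polarity ::
    "'i set \<Rightarrow> 'i set set \<Rightarrow> ('i \<Rightarrow> ('a, 'b) polarity)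
      \<Rightarrow> (('i \<Rightarrow> 'a) set, ('i \<Rightarrow> 'b) set) polarity" where
  "ultraproduct_polarity I U P =
     \<lparr>pol_X = ultra_carrier I U (\<lambda>i. pol_X (P i)),
      pol_Y = ultra_carrier I U (\<lambda>i. pol_Y (P i)),
      pol_R = {(ultra_class I U (\<lambda>i. pol_X (P i)) f, ultra_class I U (\<lambda>i. pol_Y (P i)) g) | f g.
                 f \<in> (\<Pi>\<^sub>E i\<in>I. pol_X (P i)) \<and> g \<in> (\<Pi>\<^sub>E i\<in>I. pol_Y (P i)) \<and>
                 {i \<in> I. (f i, g i) \<in> pol_R (P i)} \<in> U}\<rparr>"

text \<open>The lattice ultraproduct is given by its order; lemmas \<open>join_ultraproduct_lattice\<close> to
  \<open>bottom_ultraproduct_lattice\<close> below show that its operations are those induced by the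
  componentwise operations on representatives.\<close>

definition ultraproduct_lattice ::
    "'i set \<Rightarrow> 'i set set \<Rightarrow> ('i \<Rightarrow> 'a gorder) \<Rightarrow> ('i \<Rightarrow> 'a) set gorder" where
  "ultraproduct_lattice I U L =
     \<lparr>carrier = ultra_carrier I U (\<lambda>i. carrier (L i)),
      eq = (=),
      le = (\<lambda>a b. \<exists>f\<in>\<Pi>\<^sub>E i\<in>I. carrier (L i). \<exists>g\<in>\<Pi>\<^sub>E i\<in>I. carrier (L i).
              a = ultra_class I U (\<lambda>i. carrier (L i)) f \<and>
              b = ultra_class I U (\<lambda>i. carrier (L i)) g \<and>
              {i \<in> I. f i \<sqsubseteq>\<^bsub>L i\<^esub> g i} \<in> U)\<rparr>"

locale ultra =
  fixes I :: "'i set" and U :: "'i set set"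
  assumes ultrafilter: "ultrafilter_on I U"
begin

lemma U_mono: "A \<in> U \<Longrightarrow> A \<subseteq> B \<Longrightarrow> B \<subseteq> I \<Longrightarrow> B \<in> U"
  using ultrafilter unfolding ultrafilter_on_def by blast

lemma U_Int: "A \<in> U \<Longrightarrow> B \<in> U \<Longrightarrow> A \<inter> B \<in> U"
  using ultrafilter unfolding ultrafilter_on_def by blast

lemma U_full: "I \<in> U"
  using ultrafilter unfolding ultrafilter_on_def by blast

lemma U_mp:
  assumes "{i \<in> I. p i} \<in> U" "\<And>i. i \<in> I \<Longrightarrow> p i \<Longrightarrow> q i"
  shows "{i \<in> I. q i} \<in> U"
  using assms(1) by (rule U_mono) (use assms(2) in auto)

lemma U_conj:
  assumes "{i \<in> I. p i} \<in> U" "{i \<in> I. q i} \<in> U"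
  shows "{i \<in> I. p i \<and> q i} \<in> U"
  using U_Int[OF assms] by (rule U_mono) auto

lemma equiv_ultra_rel: "equiv (Pi\<^sub>E I X) (ultra_rel I U X)"
proof (rule equivI)
  show "ultra_rel I U X \<subseteq> Pi\<^sub>E I X \<times> Pi\<^sub>E I X"
    by (auto simp: ultra_rel_def)
  show "refl_on (Pi\<^sub>E I X) (ultra_rel I U X)"
    using U_full by (auto simp: ultra_rel_def refl_on_def)
  show "sym (ultra_rel I U X)"
    by (auto simp: ultra_rel_def sym_def eq_commute)
  show "trans (ultra_rel I U X)"
  proof (rule transI)
    fix f g h assume *: "(f, g) \<in> ultra_rel I U X" "(g, h) \<in> ultra_rel I U X"
    then have "{i \<in> I. f i = g i \<and> g i = h i} \<in> U"
      by (simp add: ultra_rel_def U_conj)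
    then have "{i \<in> I. f i = h i} \<in> U"
      by (rule U_mp) simp
    with * show "(f, h) \<in> ultra_rel I U X"
      by (simp add: ultra_rel_def)
  qed
qed

lemma ultra_class_eq_iff:
  assumes "f \<in> Pi\<^sub>E I X" "g \<in> Pi\<^sub>E I X"
  shows "ultra_class I U X f = ultra_class I U X g \<longleftrightarrow> {i \<in> I. f i = g i} \<in> U"
  using eq_equiv_class_iff[OF equiv_ultra_rel assms] assms
  by (simp add: ultra_class_def ultra_rel_def)

lemma ultra_carrier_eq: "ultra_carrier I U X = ultra_class I U X ` Pi\<^sub>E I X"
  by (auto simp: ultra_carrier_def ultra_class_def quotient_def)

lemma ultraproduct_polarity_rel_iff:
  assumes "f \<in> (\<Pi>\<^sub>E i\<in>I. pol_X (P i))" "g \<in> (\<Pi>\<^sub>E i\<in>I. pol_Y (P i))"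
  shows "(ultra_class I U (\<lambda>i. pol_X (P i)) f, ultra_class I U (\<lambda>i. pol_Y (P i)) g)
           \<in> pol_R (ultraproduct_polarity I U P) \<longleftrightarrow> {i \<in> I. (f i, g i) \<in> pol_R (P i)} \<in> U"
    (is "?l \<longleftrightarrow> ?r")
proof
  assume ?l
  then obtain f' g' where *: "f' \<in> (\<Pi>\<^sub>E i\<in>I. pol_X (P i))" "g' \<in> (\<Pi>\<^sub>E i\<in>I. pol_Y (P i))"
    "ultra_class I U (\<lambda>i. pol_X (P i)) f = ultra_class I U (\<lambda>i. pol_X (P i)) f'"
    "ultra_class I U (\<lambda>i. pol_Y (P i)) g = ultra_class I U (\<lambda>i. pol_Y (P i)) g'"
    "{i \<in> I. (f' i, g' i) \<in> pol_R (P i)} \<in> U"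
    by (auto simp: ultraproduct_polarity_def)
  then have "{i \<in> I. f i = f' i} \<in> U" "{i \<in> I. g i = g' i} \<in> U"
    using assms by (simp_all add: ultra_class_eq_iff)
  from U_conj[OF U_conj[OF this] *(5)] show ?r
    by (rule U_mp) auto
next
  assume ?r
  then show ?l using assms by (auto simp: ultraproduct_polarity_def)
qed

lemma is_polarity_ultraproduct: "is_polarity (ultraproduct_polarity I U P)"
  by (auto simp: is_polarity_def ultraproduct_polarity_def ultra_carrier_eq)

context
  fixes L :: "'i \<Rightarrow> 'a gorder"
  assumes lat: "\<And>i. i \<in> I \<Longrightarrow> bounded_lattice (L i)"
begin

abbreviation (input) "Q \<equiv> ultraproduct_lattice I U L"
abbreviation (input) "E \<equiv> \<Pi>\<^sub>E i\<in>I. carrier (L i)"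
abbreviation (input) "cl \<equiv> ultra_class I U (\<lambda>i. carrier (L i))"

lemma lattice_component: "i \<in> I \<Longrightarrow> lattice (L i)"
  using lat bounded_lattice.axioms(1) by blast

lemma partial_order_component: "i \<in> I \<Longrightarrow> partial_order (L i)"
  using lattice_component lattice.axioms(1) upper_semilattice.axioms(1) by blast

lemma ultraproduct_lattice_carrier: "carrier Q = cl ` E"
  by (simp add: ultraproduct_lattice_def ultra_carrier_eq)

lemma ultraproduct_lattice_le_iff:
  assumes "f \<in> E" "g \<in> E"
  shows "cl f \<sqsubseteq>\<^bsub>Q\<^esub> cl g \<longleftrightarrow> {i \<in> I. f i \<sqsubseteq>\<^bsub>L i\<^esub> g i} \<in> U" (is "?l \<longleftrightarrow> ?r")
proof
  assume ?l
  then obtain f' g' where *: "f' \<in> E" "g' \<in> E" "cl f = cl f'" "cl g = cl g'"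
    "{i \<in> I. f' i \<sqsubseteq>\<^bsub>L i\<^esub> g' i} \<in> U"
    by (auto simp: ultraproduct_lattice_def)
  then have "{i \<in> I. f i = f' i} \<in> U" "{i \<in> I. g i = g' i} \<in> U"
    using assms by (simp_all add: ultra_class_eq_iff)
  from U_conj[OF U_conj[OF this] *(5)] show ?r
    by (rule U_mp) auto
next
  assume ?r
  then show ?l using assms by (auto simp: ultraproduct_lattice_def)
qed

lemma partial_order_ultraproduct_lattice: "partial_order Q"
proof -
  have eq: "eq Q = (=)" by (simp add: ultraproduct_lattice_def)
  have refl: "a \<sqsubseteq>\<^bsub>Q\<^esub> a" if a: "a \<in> carrier Q" for a
  proof -
    from a obtain f where f: "f \<in> E" "a = cl f" by (auto simp: ultraproduct_lattice_carrier)
    have "f i \<sqsubseteq>\<^bsub>L i\<^esub> f i" if "i \<in> I" for i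
      using that f partial_order_component[OF that]
      by (meson PiE_mem partial_order.axioms(1) weak_partial_order.le_refl)
    then show ?thesis using f U_full by (simp add: ultraproduct_lattice_le_iff cong: conj_cong)
  qed
  have antisym: "a = b"
    if a: "a \<sqsubseteq>\<^bsub>Q\<^esub> b" "b \<sqsubseteq>\<^bsub>Q\<^esub> a" "a \<in> carrier Q" "b \<in> carrier Q" for a b
  proof -
    from a obtain f g where f: "f \<in> E" "a = cl f" "g \<in> E" "b = cl g"
      by (auto simp: ultraproduct_lattice_carrier)
    with a have "{i \<in> I. f i \<sqsubseteq>\<^bsub>L i\<^esub> g i \<and> g i \<sqsubseteq>\<^bsub>L i\<^esub> f i} \<in> U"
      by (simp add: ultraproduct_lattice_le_iff U_conj)
    then have "{i \<in> I. f i = g i} \<in> U"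
      using f partial_order_component
      by (elim U_mp) (meson PiE_mem partial_order.le_antisym)
    then show ?thesis using f by (simp add: ultra_class_eq_iff)
  qed
  have trans: "a \<sqsubseteq>\<^bsub>Q\<^esub> c"
    if a: "a \<sqsubseteq>\<^bsub>Q\<^esub> b" "b \<sqsubseteq>\<^bsub>Q\<^esub> c" "a \<in> carrier Q" "b \<in> carrier Q" "c \<in> carrier Q" for a b c
  proof -
    from a obtain f g h where f: "f \<in> E" "a = cl f" "g \<in> E" "b = cl g" "h \<in> E" "c = cl h"
      by (auto simp: ultraproduct_lattice_carrier)
    with a have "{i \<in> I. f i \<sqsubseteq>\<^bsub>L i\<^esub> g i \<and> g i \<sqsubseteq>\<^bsub>L i\<^esub> h i} \<in> U"
      by (simp add: ultraproduct_lattice_le_iff U_conj)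
    then have "{i \<in> I. f i \<sqsubseteq>\<^bsub>L i\<^esub> h i} \<in> U"
      using f partial_order_component
      by (elim U_mp) (meson PiE_mem partial_order.axioms(1) weak_partial_order.le_trans)
    then show ?thesis using f by (simp add: ultraproduct_lattice_le_iff)
  qed
  show ?thesis
    by unfold_locales (use refl antisym trans eq in \<open>auto simp: eq\<close>)
qed

lemma join_in_E:
  assumes "f \<in> E" "g \<in> E"
  shows "(\<lambda>i\<in>I. f i \<squnion>\<^bsub>L i\<^esub> g i) \<in> E"
proof (rule restrict_PiE_iff[THEN iffD2], rule ballI)
  fix i assume i: "i \<in> I"
  interpret bounded_lattice "L i" using i by (rule lat)
  show "f i \<squnion>\<^bsub>L i\<^esub> g i \<in> carrier (L i)"
    using assms i by (intro join_closed) (auto simp: PiE_mem)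
qed

lemma meet_in_E:
  assumes "f \<in> E" "g \<in> E"
  shows "(\<lambda>i\<in>I. f i \<sqinter>\<^bsub>L i\<^esub> g i) \<in> E"
proof (rule restrict_PiE_iff[THEN iffD2], rule ballI)
  fix i assume i: "i \<in> I"
  interpret bounded_lattice "L i" using i by (rule lat)
  show "f i \<sqinter>\<^bsub>L i\<^esub> g i \<in> carrier (L i)"
    using assms i by (intro meet_closed) (auto simp: PiE_mem)
qed

lemma is_lub_ultraproduct_lattice:
  assumes f: "f \<in> E" and g: "g \<in> E"
  shows "is_lub Q (cl (\<lambda>i\<in>I. f i \<squnion>\<^bsub>L i\<^esub> g i)) {cl f, cl g}"
proof (rule least_UpperI)
  let ?j = "\<lambda>i\<in>I. f i \<squnion>\<^bsub>L i\<^esub> g i"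
  note j = join_in_E[OF f g]
  show "{cl f, cl g} \<subseteq> carrier Q" "cl ?j \<in> carrier Q"
    using f g j by (auto simp: ultraproduct_lattice_carrier)
  have "f i \<sqsubseteq>\<^bsub>L i\<^esub> ?j i" "g i \<sqsubseteq>\<^bsub>L i\<^esub> ?j i" if i: "i \<in> I" for i
  proof -
    interpret bounded_lattice "L i" using i by (rule lat)
    show "f i \<sqsubseteq>\<^bsub>L i\<^esub> ?j i" "g i \<sqsubseteq>\<^bsub>L i\<^esub> ?j i"
      using PiE_mem[OF f i] PiE_mem[OF g i] i by (simp_all add: join_left join_right)
  qed
  then have "{i \<in> I. f i \<sqsubseteq>\<^bsub>L i\<^esub> ?j i} = I" "{i \<in> I. g i \<sqsubseteq>\<^bsub>L i\<^esub> ?j i} = I"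
    by blast+
  then show "x \<sqsubseteq>\<^bsub>Q\<^esub> cl ?j" if "x \<in> {cl f, cl g}" for x
    using that f g j U_full by (auto simp only: ultraproduct_lattice_le_iff)
  fix y assume "y \<in> Upper Q {cl f, cl g}"
  then obtain h where h: "h \<in> E" "y = cl h" "cl f \<sqsubseteq>\<^bsub>Q\<^esub> cl h" "cl g \<sqsubseteq>\<^bsub>Q\<^esub> cl h"
    using f g by (auto simp: Upper_def ultraproduct_lattice_carrier)
  then have "{i \<in> I. f i \<sqsubseteq>\<^bsub>L i\<^esub> h i \<and> g i \<sqsubseteq>\<^bsub>L i\<^esub> h i} \<in> U"
    using f g by (simp add: ultraproduct_lattice_le_iff U_conj)
  then have "{i \<in> I. ?j i \<sqsubseteq>\<^bsub>L i\<^esub> h i} \<in> U"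
  proof (rule U_mp)
    fix i assume i: "i \<in> I" and *: "f i \<sqsubseteq>\<^bsub>L i\<^esub> h i \<and> g i \<sqsubseteq>\<^bsub>L i\<^esub> h i"
    interpret bounded_lattice "L i" using i by (rule lat)
    show "?j i \<sqsubseteq>\<^bsub>L i\<^esub> h i"
      using i * PiE_mem[OF f i] PiE_mem[OF g i] PiE_mem[OF h(1) i] by (simp add: join_le)
  qed
  then show "cl ?j \<sqsubseteq>\<^bsub>Q\<^esub> y"
    using h j by (simp only: ultraproduct_lattice_le_iff)
qed

lemma is_glb_ultraproduct_lattice:
  assumes f: "f \<in> E" and g: "g \<in> E"
  shows "is_glb Q (cl (\<lambda>i\<in>I. f i \<sqinter>\<^bsub>L i\<^esub> g i)) {cl f, cl g}"
proof (rule greatest_LowerI)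
  let ?m = "\<lambda>i\<in>I. f i \<sqinter>\<^bsub>L i\<^esub> g i"
  note m = meet_in_E[OF f g]
  show "{cl f, cl g} \<subseteq> carrier Q" "cl ?m \<in> carrier Q"
    using f g m by (auto simp: ultraproduct_lattice_carrier)
  have "?m i \<sqsubseteq>\<^bsub>L i\<^esub> f i" "?m i \<sqsubseteq>\<^bsub>L i\<^esub> g i" if i: "i \<in> I" for i
  proof -
    interpret bounded_lattice "L i" using i by (rule lat)
    show "?m i \<sqsubseteq>\<^bsub>L i\<^esub> f i" "?m i \<sqsubseteq>\<^bsub>L i\<^esub> g i"
      using PiE_mem[OF f i] PiE_mem[OF g i] i by (simp_all add: meet_left meet_right)
  qed
  then have "{i \<in> I. ?m i \<sqsubseteq>\<^bsub>L i\<^esub> f i} = I" "{i \<in> I. ?m i \<sqsubseteq>\<^bsub>L i\<^esub> g i} = I"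
    by blast+
  then show "cl ?m \<sqsubseteq>\<^bsub>Q\<^esub> x" if "x \<in> {cl f, cl g}" for x
    using that f g m U_full by (auto simp only: ultraproduct_lattice_le_iff)
  fix y assume "y \<in> Lower Q {cl f, cl g}"
  then obtain h where h: "h \<in> E" "y = cl h" "cl h \<sqsubseteq>\<^bsub>Q\<^esub> cl f" "cl h \<sqsubseteq>\<^bsub>Q\<^esub> cl g"
    using f g by (auto simp: Lower_def ultraproduct_lattice_carrier)
  then have "{i \<in> I. h i \<sqsubseteq>\<^bsub>L i\<^esub> f i \<and> h i \<sqsubseteq>\<^bsub>L i\<^esub> g i} \<in> U"
    using f g by (simp add: ultraproduct_lattice_le_iff U_conj)
  then have "{i \<in> I. h i \<sqsubseteq>\<^bsub>L i\<^esub> ?m i} \<in> U"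
  proof (rule U_mp)
    fix i assume i: "i \<in> I" and *: "h i \<sqsubseteq>\<^bsub>L i\<^esub> f i \<and> h i \<sqsubseteq>\<^bsub>L i\<^esub> g i"
    interpret bounded_lattice "L i" using i by (rule lat)
    show "h i \<sqsubseteq>\<^bsub>L i\<^esub> ?m i"
      using i * PiE_mem[OF f i] PiE_mem[OF g i] PiE_mem[OF h(1) i] by (simp add: meet_le)
  qed
  then show "y \<sqsubseteq>\<^bsub>Q\<^esub> cl ?m"
    using h m by (simp only: ultraproduct_lattice_le_iff)
qed

lemma top_in_E: "(\<lambda>i\<in>I. \<top>\<^bsub>L i\<^esub>) \<in> E"
proof (rule restrict_PiE_iff[THEN iffD2], rule ballI)
  fix i assume i: "i \<in> I"
  interpret bounded_lattice "L i" using i by (rule lat)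
  show "\<top>\<^bsub>L i\<^esub> \<in> carrier (L i)" by (rule top_closed)
qed

lemma bottom_in_E: "(\<lambda>i\<in>I. \<bottom>\<^bsub>L i\<^esub>) \<in> E"
proof (rule restrict_PiE_iff[THEN iffD2], rule ballI)
  fix i assume i: "i \<in> I"
  interpret bounded_lattice "L i" using i by (rule lat)
  show "\<bottom>\<^bsub>L i\<^esub> \<in> carrier (L i)" by (rule bottom_closed)
qed

lemma greatest_ultraproduct_lattice: "greatest Q (cl (\<lambda>i\<in>I. \<top>\<^bsub>L i\<^esub>)) (carrier Q)"
proof -
  have "cl f \<sqsubseteq>\<^bsub>Q\<^esub> cl (\<lambda>i\<in>I. \<top>\<^bsub>L i\<^esub>)" if f: "f \<in> E" for f
  proof -
    have "f i \<sqsubseteq>\<^bsub>L i\<^esub> \<top>\<^bsub>L i\<^esub>" if i: "i \<in> I" for i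
    proof -
      interpret bounded_lattice "L i" using i by (rule lat)
      show ?thesis using PiE_mem[OF f i] by simp
    qed
    then have "{i \<in> I. f i \<sqsubseteq>\<^bsub>L i\<^esub> (\<lambda>i\<in>I. \<top>\<^bsub>L i\<^esub>) i} = I" by auto
    then show ?thesis using f top_in_E U_full by (simp only: ultraproduct_lattice_le_iff)
  qed
  then show ?thesis
    using top_in_E by (auto simp: greatest_def ultraproduct_lattice_carrier)
qed

lemma least_ultraproduct_lattice: "least Q (cl (\<lambda>i\<in>I. \<bottom>\<^bsub>L i\<^esub>)) (carrier Q)"
proof -
  have "cl (\<lambda>i\<in>I. \<bottom>\<^bsub>L i\<^esub>) \<sqsubseteq>\<^bsub>Q\<^esub> cl f" if f: "f \<in> E" for f
  proof -
    have "\<bottom>\<^bsub>L i\<^esub> \<sqsubseteq>\<^bsub>L i\<^esub> f i" if i: "i \<in> I" for i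
    proof -
      interpret bounded_lattice "L i" using i by (rule lat)
      show ?thesis using PiE_mem[OF f i] by simp
    qed
    then have "{i \<in> I. (\<lambda>i\<in>I. \<bottom>\<^bsub>L i\<^esub>) i \<sqsubseteq>\<^bsub>L i\<^esub> f i} = I" by auto
    then show ?thesis using f bottom_in_E U_full by (simp only: ultraproduct_lattice_le_iff)
  qed
  then show ?thesis
    using bottom_in_E by (auto simp: least_def ultraproduct_lattice_carrier)
qed

lemma bounded_lattice_ultraproduct_lattice: "bounded_lattice Q"
proof -
  interpret partial_order Q by (rule partial_order_ultraproduct_lattice)
  show ?thesis
  proof
    show "\<exists>s. is_lub Q s {a, b}" if ab: "a \<in> carrier Q" "b \<in> carrier Q" for a b
    proof -
      obtain f g where "f \<in> E" "a = cl f" "g \<in> E" "b = cl g"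
        using ab by (auto simp only: ultraproduct_lattice_carrier)
      then show ?thesis using is_lub_ultraproduct_lattice by blast
    qed
    show "\<exists>s. is_glb Q s {a, b}" if ab: "a \<in> carrier Q" "b \<in> carrier Q" for a b
    proof -
      obtain f g where "f \<in> E" "a = cl f" "g \<in> E" "b = cl g"
        using ab by (auto simp only: ultraproduct_lattice_carrier)
      then show ?thesis using is_glb_ultraproduct_lattice by blast
    qed
  qed (use greatest_ultraproduct_lattice least_ultraproduct_lattice in blast)+
qed

lemma join_ultraproduct_lattice:
  assumes "f \<in> E" "g \<in> E"
  shows "cl f \<squnion>\<^bsub>Q\<^esub> cl g = cl (\<lambda>i\<in>I. f i \<squnion>\<^bsub>L i\<^esub> g i)"
  by (subst join_def, subst Lattice.sup_def, rule some_equality)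
    (fact is_lub_ultraproduct_lattice[OF assms],
      rule partial_order.least_unique[OF partial_order_ultraproduct_lattice _
        is_lub_ultraproduct_lattice[OF assms]])

lemma meet_ultraproduct_lattice:
  assumes "f \<in> E" "g \<in> E"
  shows "cl f \<sqinter>\<^bsub>Q\<^esub> cl g = cl (\<lambda>i\<in>I. f i \<sqinter>\<^bsub>L i\<^esub> g i)"
  by (subst meet_def, subst Lattice.inf_def, rule some_equality)
    (fact is_glb_ultraproduct_lattice[OF assms],
      rule partial_order.greatest_unique[OF partial_order_ultraproduct_lattice _
        is_glb_ultraproduct_lattice[OF assms]])

lemma top_ultraproduct_lattice: "\<top>\<^bsub>Q\<^esub> = cl (\<lambda>i\<in>I. \<top>\<^bsub>L i\<^esub>)"
  by (subst Order.top_def, rule some_equality)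
    (fact greatest_ultraproduct_lattice,
      rule partial_order.greatest_unique[OF partial_order_ultraproduct_lattice _
        greatest_ultraproduct_lattice])

lemma bottom_ultraproduct_lattice: "\<bottom>\<^bsub>Q\<^esub> = cl (\<lambda>i\<in>I. \<bottom>\<^bsub>L i\<^esub>)"
  by (subst Order.bottom_def, rule some_equality)
    (fact least_ultraproduct_lattice,
      rule partial_order.least_unique[OF partial_order_ultraproduct_lattice _
        least_ultraproduct_lattice])

end

end


section \<open>Embeddings of bounded lattices\<close>

definition bounded_lattice_hom :: "'a gorder \<Rightarrow> 'b gorder \<Rightarrow> ('a \<Rightarrow> 'b) \<Rightarrow> bool" where
  "bounded_lattice_hom L M h \<longleftrightarrow>
     bounded_lattice L \<and> bounded_lattice M \<and> h \<in> carrier L \<rightarrow> carrier M \<and>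
     join_pres L M h \<and> meet_pres L M h \<and> h \<top>\<^bsub>L\<^esub> = \<top>\<^bsub>M\<^esub> \<and> h \<bottom>\<^bsub>L\<^esub> = \<bottom>\<^bsub>M\<^esub>"

text \<open>The ultraproduct of sets is formed from the full Cartesian product. If some \<open>X i\<close> is empty
  although almost all of them are not, that product is empty and carries no information about
  the family. The following condition rules this out; it holds whenever every \<open>X i\<close> is nonempty
  (the usual convention for ultraproducts), and also whenever almost every \<open>X i\<close> is empty.\<close>

definition ultraproduct_admissible ::
    "'i set \<Rightarrow> 'i set set \<Rightarrow> ('i \<Rightarrow> 'a set) \<Rightarrow> bool" where
  "ultraproduct_admissible I U X \<longleftrightarrow>
     ({i \<in> I. X i \<noteq> {}} \<in> U \<longrightarrow> (\<forall>i\<in>I. X i \<noteq> {}))"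

end

(* For a family of sets \<alpha> i \<subseteq> X i let the internal set of \<alpha> consist of the classes of those f with
   f i \<in> \<alpha> i for almost all i.  By the Los argument (choosing witnesses componentwise) the internal
   set construction commutes with rho and lambda, with finite unions and intersections, and reflects
   inclusion.  Joins, meets, bounds and stability are expressed by these operations alone. *)
theory Submission
  imports Defs
begin

context ultra
begin

section \<open>Logical connectives and choice modulo an ultrafilter\<close>

text \<open>A set and its complement cannot both be in \<open>U\<close>, since their intersection is
  empty; maximality of \<open>U\<close> puts one of them in.\<close>

lemma U_not_iff: "{i \<in> I. \<not> p i} \<in> U \<longleftrightarrow> {i \<in> I. p i} \<notin> U"
proof
  assume np: "{i \<in> I. \<not> p i} \<in> U"
  show "{i \<in> I. p i} \<notin> U"
  proof
    assume "{i \<in> I. p i} \<in> U"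
    from U_conj[OF this np] have "{} \<in> U" by simp
    then show False using ultrafilter by (simp add: ultrafilter_on_def)
  qed
next
  assume "{i \<in> I. p i} \<notin> U"
  moreover have "\<forall>A. A \<subseteq> I \<longrightarrow> A \<in> U \<or> I - A \<in> U"
    using ultrafilter unfolding ultrafilter_on_def by (elim conjE)
  then have "{i \<in> I. p i} \<in> U \<or> I - {i \<in> I. p i} \<in> U" by simp
  ultimately have "I - {i \<in> I. p i} \<in> U" by simp
  then show "{i \<in> I. \<not> p i} \<in> U" by (rule U_mono) auto
qed

text \<open>Primeness of ultrafilters: if the second set is not in \<open>U\<close>, its complement
  is, and intersecting with that complement leaves the first alternative.\<close>

lemma U_disj_iff:
  "{i \<in> I. p i \<or> q i} \<in> U \<longleftrightarrow> {i \<in> I. p i} \<in> U \<or> {i \<in> I. q i} \<in> U"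
proof
  assume pq: "{i \<in> I. p i \<or> q i} \<in> U"
  show "{i \<in> I. p i} \<in> U \<or> {i \<in> I. q i} \<in> U"
  proof (rule disjCI)
    assume "{i \<in> I. q i} \<notin> U"
    then have "{i \<in> I. \<not> q i} \<in> U" by (simp add: U_not_iff)
    from U_conj[OF pq this] show "{i \<in> I. p i} \<in> U" by (rule U_mp) auto
  qed
next
  assume "{i \<in> I. p i} \<in> U \<or> {i \<in> I. q i} \<in> U"
  then show "{i \<in> I. p i \<or> q i} \<in> U"
    by (rule disjE) (erule U_mp, simp)+
qed

lemma U_conj_iff:
  "{i \<in> I. p i \<and> q i} \<in> U \<longleftrightarrow> {i \<in> I. p i} \<in> U \<and> {i \<in> I. q i} \<in> U"
proof
  assume pq: "{i \<in> I. p i \<and> q i} \<in> U"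
  show "{i \<in> I. p i} \<in> U \<and> {i \<in> I. q i} \<in> U"
    by (intro conjI; rule U_mp[OF pq]) simp_all
qed (simp add: U_conj)

text \<open>Witnesses for almost all indices make almost all \<open>X i\<close> nonempty, so by
  admissibility every \<open>X i\<close> is nonempty and the witnesses extend to a member of the
  full product.\<close>

lemma U_choice:
  assumes adm: "ultraproduct_admissible I U X"
    and ex: "{i \<in> I. \<exists>x\<in>X i. p i x} \<in> U"
  obtains f where "f \<in> Pi\<^sub>E I X" "{i \<in> I. p i (f i)} \<in> U"
proof -
  have "{i \<in> I. X i \<noteq> {}} \<in> U" using ex by (rule U_mp) auto
  with adm have ne: "X i \<noteq> {}" if "i \<in> I" for i
    using that by (simp add: ultraproduct_admissible_def)
  \<comment> \<open>The implication supplies a default: where \<open>p i\<close> has no witness, an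
    arbitrary element of the nonempty \<open>X i\<close> is taken, so that \<open>f\<close> still
    lies in the product.\<close>
  define f where
    "f = (\<lambda>i\<in>I. SOME x. x \<in> X i \<and> ((\<exists>y\<in>X i. p i y) \<longrightarrow> p i x))"
  have f: "f i \<in> X i \<and> ((\<exists>y\<in>X i. p i y) \<longrightarrow> p i (f i))" if i: "i \<in> I" for i
  proof -
    have "\<exists>x. x \<in> X i \<and> ((\<exists>y\<in>X i. p i y) \<longrightarrow> p i x)" using ne[OF i] by blast
    from someI_ex[OF this] show ?thesis using i by (simp add: f_def)
  qed
  show thesis
  proof (rule that)
    show "f \<in> Pi\<^sub>E I X" using f by (auto simp: f_def)
    show "{i \<in> I. p i (f i)} \<in> U" using ex by (rule U_mp) (use f in blast)
  qed
qed

section \<open>Internal sets of an ultraproduct\<close>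

text \<open>Classes are formed in the product of \<open>X\<close>, not of \<alpha>, so that they are
  points of the ultraproduct of \<open>X\<close> and a few empty \<alpha> i do no harm. Inclusion of
  \<alpha> in \<open>X\<close> is not built in: \<alpha> may be any family of predicates.\<close>

definition internal :: "('i \<Rightarrow> 'a set) \<Rightarrow> ('i \<Rightarrow> 'a set) \<Rightarrow> ('i \<Rightarrow> 'a) set set" where
  "internal X \<alpha> = {ultra_class I U X f | f. f \<in> Pi\<^sub>E I X \<and> {i \<in> I. f i \<in> \<alpha> i} \<in> U}"

text \<open>Membership does not depend on the representative, because two representatives of a class
  agree on a set in \<open>U\<close>.\<close>

lemma ultra_class_in_internal_iff:
  assumes "f \<in> Pi\<^sub>E I X"
  shows "ultra_class I U X f \<in> internal X \<alpha> \<longleftrightarrow> {i \<in> I. f i \<in> \<alpha> i} \<in> U"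
proof
  assume "ultra_class I U X f \<in> internal X \<alpha>"
  then obtain g where g: "g \<in> Pi\<^sub>E I X" "ultra_class I U X f = ultra_class I U X g"
    "{i \<in> I. g i \<in> \<alpha> i} \<in> U"
    by (auto simp: internal_def)
  then have "{i \<in> I. f i = g i} \<in> U" using assms by (simp add: ultra_class_eq_iff)
  from U_conj[OF this g(3)] show "{i \<in> I. f i \<in> \<alpha> i} \<in> U" by (rule U_mp) auto
qed (use assms in \<open>auto simp: internal_def\<close>)

lemma ball_internal_iff:
  "(\<forall>a\<in>internal X \<alpha>. p a) \<longleftrightarrow>
   (\<forall>f\<in>Pi\<^sub>E I X. {i \<in> I. f i \<in> \<alpha> i} \<in> U \<longrightarrow> p (ultra_class I U X f))"
  by (auto simp: internal_def)

lemma internal_subset_carrier: "internal X \<alpha> \<subseteq> ultra_carrier I U X"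
  by (auto simp: internal_def ultra_carrier_eq)

text \<open>Reduces an identity between sets of classes to a statement about representatives, to
  which the rules for connectives modulo \<open>U\<close> apply.\<close>

lemma internal_eqI:
  assumes "S \<subseteq> ultra_carrier I U X"
    and "\<And>f. f \<in> Pi\<^sub>E I X \<Longrightarrow> ultra_class I U X f \<in> S \<longleftrightarrow> {i \<in> I. f i \<in> \<alpha> i} \<in> U"
  shows "S = internal X \<alpha>"
proof (rule Set.set_eqI)
  fix x
  show "x \<in> S \<longleftrightarrow> x \<in> internal X \<alpha>"
  proof (cases "x \<in> ultra_carrier I U X")
    case True
    then obtain f where "f \<in> Pi\<^sub>E I X" "x = ultra_class I U X f"
      by (auto simp: ultra_carrier_eq)
    then show ?thesis using assms(2) by (simp add: ultra_class_in_internal_iff)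
  next
    case False
    then show ?thesis using assms(1) internal_subset_carrier by blast
  qed
qed

lemma internal_full: "internal X X = ultra_carrier I U X"
proof -
  have "{i \<in> I. f i \<in> X i} \<in> U" if "f \<in> Pi\<^sub>E I X" for f
    using that by (intro U_mono[OF U_full]) auto
  then show ?thesis by (auto simp: internal_def ultra_carrier_eq)
qed

lemma internal_Un: "internal X \<alpha> \<union> internal X \<beta> = internal X (\<lambda>i. \<alpha> i \<union> \<beta> i)"
  using internal_subset_carrier
  by (intro internal_eqI) (auto simp: ultra_class_in_internal_iff U_disj_iff)

lemma internal_Int: "internal X \<alpha> \<inter> internal X \<beta> = internal X (\<lambda>i. \<alpha> i \<inter> \<beta> i)"
  using internal_subset_carrier
  by (intro internal_eqI) (auto simp: ultra_class_in_internal_iff U_conj_iff)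

text \<open>Members of the lattice ultraproduct are represented by families restricted to
  \<open>I\<close>, while the polarity operations yield unrestricted families; agreement on
  \<open>I\<close> suffices to pass between them.\<close>

lemma internal_cong: "(\<And>i. i \<in> I \<Longrightarrow> \<alpha> i = \<beta> i) \<Longrightarrow> internal X \<alpha> = internal X \<beta>"
  by (simp add: internal_def cong: conj_cong)

text \<open>If inclusion fails at almost all indices, \<open>U_choice\<close> selects
  counterexamples componentwise, and their class separates the two internal sets. The bound on
  \<alpha> places the counterexamples in \<open>X i\<close>, from which the choice is made.\<close>

lemma internal_subset_iff:
  assumes adm: "ultraproduct_admissible I U X" and \<alpha>: "\<And>i. i \<in> I \<Longrightarrow> \<alpha> i \<subseteq> X i"
  shows "internal X \<alpha> \<subseteq> internal X \<beta> \<longleftrightarrow> {i \<in> I. \<alpha> i \<subseteq> \<beta> i} \<in> U"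
proof
  assume sub: "internal X \<alpha> \<subseteq> internal X \<beta>"
  show "{i \<in> I. \<alpha> i \<subseteq> \<beta> i} \<in> U"
  proof (rule ccontr)
    assume "{i \<in> I. \<alpha> i \<subseteq> \<beta> i} \<notin> U"
    then have "{i \<in> I. \<not> \<alpha> i \<subseteq> \<beta> i} \<in> U" by (simp add: U_not_iff)
    then have "{i \<in> I. \<exists>x\<in>X i. x \<in> \<alpha> i \<and> x \<notin> \<beta> i} \<in> U"
      by (rule U_mp) (use \<alpha> in blast)
    then obtain f where f: "f \<in> Pi\<^sub>E I X" "{i \<in> I. f i \<in> \<alpha> i \<and> f i \<notin> \<beta> i} \<in> U"
      by (rule U_choice[OF adm])
    have "{i \<in> I. f i \<in> \<alpha> i} \<in> U" "{i \<in> I. f i \<notin> \<beta> i} \<in> U"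
      using f(2) by (simp_all add: U_conj_iff)
    \<comment> \<open>Read backwards, the membership criterion puts the class of \<open>f\<close>
      into the internal set of \<alpha> and outside that of \<beta>.\<close>
    with sub show False
      by (auto simp: U_not_iff subset_iff simp flip: ultra_class_in_internal_iff[OF f(1)])
  qed
next
  assume sub: "{i \<in> I. \<alpha> i \<subseteq> \<beta> i} \<in> U"
  have "{i \<in> I. f i \<in> \<beta> i} \<in> U" if "{i \<in> I. f i \<in> \<alpha> i} \<in> U" for f
    using U_conj[OF sub that] by (rule U_mp) auto
  then show "internal X \<alpha> \<subseteq> internal X \<beta>" by (auto simp: internal_def)
qed

text \<open>Read from right to left this makes the embedding well defined on classes of families;
  read from left to right it makes the embedding injective.\<close>

lemma internal_eq_iff:
  assumes "ultraproduct_admissible I U X"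
    and "\<And>i. i \<in> I \<Longrightarrow> \<alpha> i \<subseteq> X i" "\<And>i. i \<in> I \<Longrightarrow> \<beta> i \<subseteq> X i"
  shows "internal X \<alpha> = internal X \<beta> \<longleftrightarrow> {i \<in> I. \<alpha> i = \<beta> i} \<in> U"
proof -
  have "internal X \<alpha> = internal X \<beta> \<longleftrightarrow>
      {i \<in> I. \<alpha> i \<subseteq> \<beta> i} \<in> U \<and> {i \<in> I. \<beta> i \<subseteq> \<alpha> i} \<in> U"
    using internal_subset_iff[of X \<alpha> \<beta>] internal_subset_iff[of X \<beta> \<alpha>] assms by blast
  also have "\<dots> \<longleftrightarrow> {i \<in> I. \<alpha> i \<subseteq> \<beta> i \<and> \<beta> i \<subseteq> \<alpha> i} \<in> U"
    by (simp add: U_conj_iff)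
  finally show ?thesis by (simp add: set_eq_subset)
qed

text \<open>The Los step for a bounded universal quantifier: it is an inclusion of internal sets,
  the larger one given by the family of predicates \<open>q i\<close>.\<close>

lemma U_ball_iff:
  assumes adm: "ultraproduct_admissible I U X" and \<alpha>: "\<And>i. i \<in> I \<Longrightarrow> \<alpha> i \<subseteq> X i"
  shows "(\<forall>f\<in>Pi\<^sub>E I X. {i \<in> I. f i \<in> \<alpha> i} \<in> U \<longrightarrow> {i \<in> I. q i (f i)} \<in> U) \<longleftrightarrow>
         {i \<in> I. \<forall>x\<in>\<alpha> i. q i x} \<in> U"
proof -
  have "(\<forall>f\<in>Pi\<^sub>E I X. {i \<in> I. f i \<in> \<alpha> i} \<in> U \<longrightarrow> {i \<in> I. q i (f i)} \<in> U) \<longleftrightarrow>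
      internal X \<alpha> \<subseteq> internal X (\<lambda>i. {x. q i x})"
    by (simp add: subset_eq ball_internal_iff ultra_class_in_internal_iff)
  also have "\<dots> \<longleftrightarrow> {i \<in> I. \<forall>x\<in>\<alpha> i. q i x} \<in> U"
    using internal_subset_iff[OF adm \<alpha>, where \<beta> = "\<lambda>i. {x. q i x}"]
    by (simp add: subset_iff Ball_def)
  finally show ?thesis .
qed

text \<open>The union over all representatives avoids choosing one; on a class of stable families
  all its members contribute the same set.\<close>

definition embedding ::
    "('i \<Rightarrow> 'a set) \<Rightarrow> ('i \<Rightarrow> 'a set) set \<Rightarrow> ('i \<Rightarrow> 'a) set set" where
  "embedding X A = (\<Union>\<alpha>\<in>A. internal X \<alpha>)"

section \<open>Polarity and lattice operations on internal sets\<close>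

context
  fixes P :: "'i \<Rightarrow> ('a, 'b) polarity"
  assumes adm_X: "ultraproduct_admissible I U (\<lambda>i. pol_X (P i))"
    and adm_Y: "ultraproduct_admissible I U (\<lambda>i. pol_Y (P i))"
begin

abbreviation (input) "X \<equiv> \<lambda>i. pol_X (P i)"
abbreviation (input) "Y \<equiv> \<lambda>i. pol_Y (P i)"
abbreviation (input) "PU \<equiv> ultraproduct_polarity I U P"
abbreviation (input) "L \<equiv> \<lambda>i. stable_lattice (P i)"

lemma pol_X_ultraproduct: "pol_X PU = ultra_carrier I U X"
  and pol_Y_ultraproduct: "pol_Y PU = ultra_carrier I U Y"
  by (simp_all add: ultraproduct_polarity_def)

text \<open>Membership of the class of \<open>g\<close> quantifies over all \<open>f\<close> almost
  everywhere in \<alpha>. \<open>U_ball_iff\<close> moves this quantifier inside the index set,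
  which is where admissibility of \<open>X\<close> enters.\<close>

lemma rho_internal:
  assumes \<alpha>: "\<And>i. i \<in> I \<Longrightarrow> \<alpha> i \<subseteq> X i"
  shows "rho PU (internal X \<alpha>) = internal Y (\<lambda>i. rho (P i) (\<alpha> i))"
proof (rule internal_eqI)
  show "rho PU (internal X \<alpha>) \<subseteq> ultra_carrier I U Y"
    by (auto simp: rho_def pol_Y_ultraproduct)
  fix g assume g: "g \<in> Pi\<^sub>E I Y"
  have "ultra_class I U Y g \<in> rho PU (internal X \<alpha>) \<longleftrightarrow>
      (\<forall>f\<in>Pi\<^sub>E I X. {i \<in> I. f i \<in> \<alpha> i} \<in> U \<longrightarrow> {i \<in> I. (f i, g i) \<in> pol_R (P i)} \<in> U)"
    using g by (simp add: rho_def pol_Y_ultraproduct ultra_carrier_eq ball_internal_iff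
        ultraproduct_polarity_rel_iff)
  also have "\<dots> \<longleftrightarrow> {i \<in> I. \<forall>x\<in>\<alpha> i. (x, g i) \<in> pol_R (P i)} \<in> U"
    using adm_X \<alpha> by (rule U_ball_iff)
  also have "{i \<in> I. \<forall>x\<in>\<alpha> i. (x, g i) \<in> pol_R (P i)} = {i \<in> I. g i \<in> rho (P i) (\<alpha> i)}"
    using g by (auto simp: rho_def)
  finally show "ultra_class I U Y g \<in> rho PU (internal X \<alpha>) \<longleftrightarrow>
      {i \<in> I. g i \<in> rho (P i) (\<alpha> i)} \<in> U" .
qed

text \<open>Dual to \<open>rho_internal\<close>: the quantifier now ranges over the product of
  \<open>Y\<close>, so admissibility of \<open>Y\<close> is used.\<close>

lemma lambda_internal:
  assumes \<beta>: "\<And>i. i \<in> I \<Longrightarrow> \<beta> i \<subseteq> Y i"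
  shows "lambda PU (internal Y \<beta>) = internal X (\<lambda>i. lambda (P i) (\<beta> i))"
proof (rule internal_eqI)
  show "lambda PU (internal Y \<beta>) \<subseteq> ultra_carrier I U X"
    by (auto simp: lambda_def pol_X_ultraproduct)
  fix f assume f: "f \<in> Pi\<^sub>E I X"
  have "ultra_class I U X f \<in> lambda PU (internal Y \<beta>) \<longleftrightarrow>
      (\<forall>g\<in>Pi\<^sub>E I Y. {i \<in> I. g i \<in> \<beta> i} \<in> U \<longrightarrow> {i \<in> I. (f i, g i) \<in> pol_R (P i)} \<in> U)"
    using f by (simp add: lambda_def pol_X_ultraproduct ultra_carrier_eq ball_internal_iff
        ultraproduct_polarity_rel_iff)
  also have "\<dots> \<longleftrightarrow> {i \<in> I. \<forall>y\<in>\<beta> i. (f i, y) \<in> pol_R (P i)} \<in> U"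
    using adm_Y \<beta> by (rule U_ball_iff)
  also have "{i \<in> I. \<forall>y\<in>\<beta> i. (f i, y) \<in> pol_R (P i)} = {i \<in> I. f i \<in> lambda (P i) (\<beta> i)}"
    using f by (auto simp: lambda_def)
  finally show "ultra_class I U X f \<in> lambda PU (internal Y \<beta>) \<longleftrightarrow>
      {i \<in> I. f i \<in> lambda (P i) (\<beta> i)} \<in> U" .
qed

lemma closure_internal:
  assumes "\<And>i. i \<in> I \<Longrightarrow> \<alpha> i \<subseteq> X i"
  shows "lambda PU (rho PU (internal X \<alpha>)) = internal X (\<lambda>i. lambda (P i) (rho (P i) (\<alpha> i)))"
  using assms by (simp add: rho_internal lambda_internal)

text \<open>Stability is a fixed point equation for the closure, and the closure of an internal set
  is computed componentwise.\<close>

lemma stable_internal: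
  assumes "\<And>i. i \<in> I \<Longrightarrow> stable (P i) (\<alpha> i)"
  shows "stable PU (internal X \<alpha>)"
proof -
  have "lambda PU (rho PU (internal X \<alpha>)) = internal X \<alpha>"
    using assms closure_internal[of \<alpha>]
      internal_cong[of "\<lambda>i. lambda (P i) (rho (P i) (\<alpha> i))" \<alpha> X]
    by (simp add: stable_def)
  then show ?thesis
    using internal_subset_carrier by (simp add: stable_def pol_X_ultraproduct)
qed

text \<open>The join is the closure of the union, and internal sets commute with both. The
  restricted family on the right is the representative in
  \<open>join_ultraproduct_lattice\<close>.\<close>

lemma join_internal:
  assumes "\<And>i. i \<in> I \<Longrightarrow> stable (P i) (\<alpha> i)" "\<And>i. i \<in> I \<Longrightarrow> stable (P i) (\<beta> i)"
  shows "internal X \<alpha> \<squnion>\<^bsub>stable_lattice PU\<^esub> internal X \<beta> =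
         internal X (\<lambda>i\<in>I. \<alpha> i \<squnion>\<^bsub>L i\<^esub> \<beta> i)"
  using assms
  by (simp add: join_stable_lattice stable_internal internal_Un closure_internal stable_subset
      cong: internal_cong)

lemma meet_internal:
  assumes "\<And>i. i \<in> I \<Longrightarrow> stable (P i) (\<alpha> i)" "\<And>i. i \<in> I \<Longrightarrow> stable (P i) (\<beta> i)"
  shows "internal X \<alpha> \<sqinter>\<^bsub>stable_lattice PU\<^esub> internal X \<beta> =
         internal X (\<lambda>i\<in>I. \<alpha> i \<sqinter>\<^bsub>L i\<^esub> \<beta> i)"
  using assms
  by (simp add: meet_stable_lattice stable_internal internal_Int cong: internal_cong)

lemma top_internal: "\<top>\<^bsub>stable_lattice PU\<^esub> = internal X (\<lambda>i\<in>I. \<top>\<^bsub>L i\<^esub>)"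
proof -
  have "internal X (\<lambda>i\<in>I. \<top>\<^bsub>L i\<^esub>) = internal X X"
    by (rule internal_cong) (simp add: top_stable_lattice)
  then show ?thesis by (simp add: top_stable_lattice internal_full pol_X_ultraproduct)
qed

text \<open>The bottom is \<open>lambda\<close> of the whole second sort, which is itself the
  internal set of \<open>Y\<close>, so \<open>lambda_internal\<close> applies.\<close>

lemma bottom_internal: "\<bottom>\<^bsub>stable_lattice PU\<^esub> = internal X (\<lambda>i\<in>I. \<bottom>\<^bsub>L i\<^esub>)"
proof -
  have "internal X (\<lambda>i\<in>I. \<bottom>\<^bsub>L i\<^esub>) = internal X (\<lambda>i. lambda (P i) (Y i))"
    by (rule internal_cong) (simp add: bottom_stable_lattice)
  also have "\<dots> = lambda PU (internal Y Y)" by (simp add: lambda_internal)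
  finally show ?thesis by (simp add: bottom_stable_lattice internal_full pol_Y_ultraproduct)
qed

section \<open>The embedding of the lattice ultraproduct\<close>

text \<open>Any two representatives agree almost everywhere and so have equal internal sets; since
  \<alpha> lies in its own class, the union collapses to the internal set of \<alpha>.\<close>

lemma embedding_ultra_class:
  assumes \<alpha>: "\<alpha> \<in> (\<Pi>\<^sub>E i\<in>I. carrier (L i))"
  shows "embedding X (ultra_class I U (\<lambda>i. carrier (L i)) \<alpha>) = internal X \<alpha>"
proof -
  have "internal X \<beta> = internal X \<alpha>"
    if "\<beta> \<in> ultra_class I U (\<lambda>i. carrier (L i)) \<alpha>" for \<beta>
  proof -
    from that have \<beta>: "\<beta> \<in> (\<Pi>\<^sub>E i\<in>I. carrier (L i))" "{i \<in> I. \<alpha> i = \<beta> i} \<in> U"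
      by (auto simp: ultra_class_def ultra_rel_def)
    have "\<alpha> i \<subseteq> X i" "\<beta> i \<subseteq> X i" if "i \<in> I" for i
      using PiE_mem[OF \<alpha> that] PiE_mem[OF \<beta>(1) that] by (simp_all add: stable_subset)
    with \<beta>(2) show ?thesis using internal_eq_iff[OF adm_X, of \<alpha> \<beta>] by simp
  qed
  moreover have "\<alpha> \<in> ultra_class I U (\<lambda>i. carrier (L i)) \<alpha>"
    using \<alpha> equiv_class_self[OF equiv_ultra_rel] by (simp add: ultra_class_def)
  ultimately show ?thesis unfolding embedding_def by blast
qed

lemma inj_on_embedding: "inj_on (embedding X) (carrier (ultraproduct_lattice I U L))"
proof (rule inj_onI)
  fix a b
  assume ab: "a \<in> carrier (ultraproduct_lattice I U L)" "b \<in> carrier (ultraproduct_lattice I U L)"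
    and eq: "embedding X a = embedding X b"
  obtain \<alpha> \<beta> where \<alpha>: "\<alpha> \<in> (\<Pi>\<^sub>E i\<in>I. carrier (L i))" "a = ultra_class I U (\<lambda>i. carrier (L i)) \<alpha>"
    and \<beta>: "\<beta> \<in> (\<Pi>\<^sub>E i\<in>I. carrier (L i))" "b = ultra_class I U (\<lambda>i. carrier (L i)) \<beta>"
    using ab by (auto simp: ultraproduct_lattice_def ultra_carrier_eq)
  have sub: "\<alpha> i \<subseteq> X i" "\<beta> i \<subseteq> X i" if "i \<in> I" for i
    using PiE_mem[OF \<alpha>(1) that] PiE_mem[OF \<beta>(1) that] by (simp_all add: stable_subset)
  have "internal X \<alpha> = internal X \<beta>"
    using eq \<alpha> \<beta> by (simp add: embedding_ultra_class)
  then have "{i \<in> I. \<alpha> i = \<beta> i} \<in> U"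
    using internal_eq_iff[OF adm_X sub] by simp
  then show "a = b" using \<alpha> \<beta> by (simp add: ultra_class_eq_iff)
qed

lemma bounded_lattice_hom_embedding:
  "bounded_lattice_hom (ultraproduct_lattice I U L) (stable_lattice PU) (embedding X)"
proof -
  note bl = bounded_lattice_stable_lattice
  have stab: "stable (P i) (\<alpha> i)" if "\<alpha> \<in> (\<Pi>\<^sub>E i\<in>I. carrier (L i))" "i \<in> I" for \<alpha> i
    using PiE_mem[OF that] by simp
  \<comment> \<open>The facts on lattice ultraproducts assume bounded lattices as components; here
    and below \<open>OF bl\<close> discharges this for the stable set lattices.\<close>
  note carr = ultraproduct_lattice_carrier[where L = L, OF bl]
  have lattices: "lattice (ultraproduct_lattice I U L)" "lattice (stable_lattice PU)"
    using bounded_lattice.axioms(1) bounded_lattice_ultraproduct_lattice[where L = L, OF bl] bl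
    by blast+
  have closed: "embedding X \<in> carrier (ultraproduct_lattice I U L) \<rightarrow> carrier (stable_lattice PU)"
    using stab by (auto simp: carr embedding_ultra_class stable_internal)
  have join: "embedding X (a \<squnion>\<^bsub>ultraproduct_lattice I U L\<^esub> b) =
      embedding X a \<squnion>\<^bsub>stable_lattice PU\<^esub> embedding X b"
    and meet: "embedding X (a \<sqinter>\<^bsub>ultraproduct_lattice I U L\<^esub> b) =
      embedding X a \<sqinter>\<^bsub>stable_lattice PU\<^esub> embedding X b"
    if "a \<in> carrier (ultraproduct_lattice I U L)" "b \<in> carrier (ultraproduct_lattice I U L)"
    for a b
  proof -
    obtain \<alpha> \<beta> where \<alpha>: "\<alpha> \<in> (\<Pi>\<^sub>E i\<in>I. carrier (L i))"
        "a = ultra_class I U (\<lambda>i. carrier (L i)) \<alpha>"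
      and \<beta>: "\<beta> \<in> (\<Pi>\<^sub>E i\<in>I. carrier (L i))" "b = ultra_class I U (\<lambda>i. carrier (L i)) \<beta>"
      using \<open>a \<in> _\<close> \<open>b \<in> _\<close> unfolding carr by blast
    note in_E = join_in_E[where L = L, OF bl \<alpha>(1) \<beta>(1)] meet_in_E[where L = L, OF bl \<alpha>(1) \<beta>(1)]
    \<comment> \<open>On representatives, the join in the ultraproduct is the class of the
      componentwise joins, so the claim turns into \<open>join_internal\<close>.\<close>
    show "embedding X (a \<squnion>\<^bsub>ultraproduct_lattice I U L\<^esub> b) =
        embedding X a \<squnion>\<^bsub>stable_lattice PU\<^esub> embedding X b"
      unfolding \<alpha>(2) \<beta>(2) join_ultraproduct_lattice[where L = L, OF bl \<alpha>(1) \<beta>(1)]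
        embedding_ultra_class[OF \<alpha>(1)] embedding_ultra_class[OF \<beta>(1)]
        embedding_ultra_class[OF in_E(1)]
      using join_internal[OF stab[OF \<alpha>(1)] stab[OF \<beta>(1)]] by simp
    show "embedding X (a \<sqinter>\<^bsub>ultraproduct_lattice I U L\<^esub> b) =
        embedding X a \<sqinter>\<^bsub>stable_lattice PU\<^esub> embedding X b"
      unfolding \<alpha>(2) \<beta>(2) meet_ultraproduct_lattice[where L = L, OF bl \<alpha>(1) \<beta>(1)]
        embedding_ultra_class[OF \<alpha>(1)] embedding_ultra_class[OF \<beta>(1)]
        embedding_ultra_class[OF in_E(2)]
      using meet_internal[OF stab[OF \<alpha>(1)] stab[OF \<beta>(1)]] by simp
  qed
  have "embedding X \<top>\<^bsub>ultraproduct_lattice I U L\<^esub> = \<top>\<^bsub>stable_lattice PU\<^esub>"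
    unfolding top_ultraproduct_lattice[where L = L, OF bl]
      embedding_ultra_class[OF top_in_E[where L = L, OF bl]] top_internal ..
  moreover have "embedding X \<bottom>\<^bsub>ultraproduct_lattice I U L\<^esub> = \<bottom>\<^bsub>stable_lattice PU\<^esub>"
    unfolding bottom_ultraproduct_lattice[where L = L, OF bl]
      embedding_ultra_class[OF bottom_in_E[where L = L, OF bl]] bottom_internal ..
  ultimately show ?thesis
    unfolding bounded_lattice_hom_def join_pres_def meet_pres_def
    using bounded_lattice_ultraproduct_lattice[where L = L, OF bl] bl lattices closed join meet
    by blast
qed

end

end

theorem theorem5p3:
  fixes I :: "'i set" and U :: "'i set set" and P :: "'i \<Rightarrow> ('a, 'b) polarity"
  assumes "ultrafilter_on I U"
    and "\<And>i. i \<in> I \<Longrightarrow> is_polarity (P i)"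
    and "ultraproduct_admissible I U (\<lambda>i. pol_X (P i))"
    and "ultraproduct_admissible I U (\<lambda>i. pol_Y (P i))"
  shows "\<exists>h. bounded_lattice_hom
               (ultraproduct_lattice I U (\<lambda>i. stable_lattice (P i)))
               (stable_lattice (ultraproduct_polarity I U P)) h \<and>
             inj_on h (carrier (ultraproduct_lattice I U (\<lambda>i. stable_lattice (P i)))) \<and>
             (\<forall>\<alpha> \<in> \<Pi>\<^sub>E i\<in>I. carrier (stable_lattice (P i)).
                h (ultra_class I U (\<lambda>i. carrier (stable_lattice (P i))) \<alpha>) =
                  {ultra_class I U (\<lambda>i. pol_X (P i)) f | f.
                     f \<in> (\<Pi>\<^sub>E i\<in>I. pol_X (P i)) \<and> {i \<in> I. f i \<in> \<alpha> i} \<in> U})"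
proof -
  interpret ultra I U by unfold_locales fact
  note adm = assms(3,4)
  show ?thesis
  proof (intro exI conjI ballI)
    \<comment> \<open>The existential witness is left open by \<open>exI\<close> and becomes
      \<open>embedding\<close> here.\<close>
    show "bounded_lattice_hom (ultraproduct_lattice I U (\<lambda>i. stable_lattice (P i)))
        (stable_lattice (ultraproduct_polarity I U P)) (embedding (\<lambda>i. pol_X (P i)))"
      by (rule bounded_lattice_hom_embedding[OF adm])
    show "inj_on (embedding (\<lambda>i. pol_X (P i)))
        (carrier (ultraproduct_lattice I U (\<lambda>i. stable_lattice (P i))))"
      by (rule inj_on_embedding[OF adm])
    fix \<alpha> assume "\<alpha> \<in> (\<Pi>\<^sub>E i\<in>I. carrier (stable_lattice (P i)))"
    then show "embedding (\<lambda>i. pol_X (P i))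
          (ultra_class I U (\<lambda>i. carrier (stable_lattice (P i))) \<alpha>) =
        {ultra_class I U (\<lambda>i. pol_X (P i)) f | f.
           f \<in> (\<Pi>\<^sub>E i\<in>I. pol_X (P i)) \<and> {i \<in> I. f i \<in> \<alpha> i} \<in> U}"
      \<comment> \<open>The value is the internal set of \<alpha>, whose definition is exactly the
        required formula.\<close>
      by (simp only: embedding_ultra_class[OF adm] internal_def)
  qed
qed

end
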